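(* Let $p \geq 2$ and $n \geq p+2$ be integers, and let $T$ be a tournament with vertex set $[n]$. Then $T$ is $(=p)$-invertible if and only if $p$ is even or $|\{i \in [n] \mid d^+(i) \text{ is even}\}| = \lceil n/2 \rceil$.
   Context: For an oriented graph $D$ and $X\subseteq V(D)$, the inversion of $X$ reverses the orientation of every arc with both endpoints in $X$. A $(=p)$-inversion is the inversion of a set of exactly $p$ vertices. An oriented graph is $(=p)$-invertible if it can be made acyclic by a (finite, possibly empty) sequence of $(=p)$-inversions. $d^+(i)$ denotes the out-degree of $i$ in $T$. *)

theory Defs
  imports Complex_Main "Graph_Theory.Graph_Theory"
begin

locale oriented_graph = pair_digraph D for D :: "'a pair_pre_digraph" +
  assumes no_antiparallel: "(u, v) \<in> parcs D \<Longrightarrow> (v, u) \<notin> parcs D"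

locale tournament = oriented_graph T for T :: "'a pair_pre_digraph" +
  assumes adjacent: "u \<in> pverts T \<Longrightarrow> v \<in> pverts T \<Longrightarrow> u \<noteq> v \<Longrightarrow>
    (u, v) \<in> parcs T \<or> (v, u) \<in> parcs T"

definition invert :: "'a pair_pre_digraph \<Rightarrow> 'a set \<Rightarrow> 'a pair_pre_digraph" where
  "invert D X = D\<lparr>parcs := {(u, v) \<in> parcs D. \<not> (u \<in> X \<and> v \<in> X)} \<union>
                           {(v, u) | u v. (u, v) \<in> parcs D \<and> u \<in> X \<and> v \<in> X}\<rparr>"

definition acyclic_digraph :: "'a pair_pre_digraph \<Rightarrow> bool" where
  "acyclic_digraph D \<longleftrightarrow> (\<nexists>c. pre_digraph.cycle (with_proj D) c)"

text \<open>The list \<open>Xs\<close> is the sequence of inverted vertex sets; inversions never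
  change the vertex set, so it suffices to bound each set by that of \<open>D\<close>.\<close>
definition eq_invertible :: "nat \<Rightarrow> 'a pair_pre_digraph \<Rightarrow> bool" where
  "eq_invertible p D \<longleftrightarrow>
    (\<exists>Xs. (\<forall>X \<in> set Xs. X \<subseteq> pverts D \<and> card X = p) \<and> acyclic_digraph (foldl invert D Xs))"

end

theory Submission
  imports Defs
begin

text \<open>
  On the arc set of a tournament, inverting \<open>X\<close> is adding the (symmetric) edge set of the
  clique on \<open>X\<close> over \<open>GF(2)\<close>, so everything depends on the span \<open>W\<close> of the \<open>p\<close>-cliques.
  Since \<open>n \<ge> p + 2\<close>, four suitable cliques add up to a 4-cycle, hence \<open>W\<close> contains all
  4-cycles.

  If \<open>p\<close> is even, then modulo 4-cycles the sum of two cliques differing in one vertex is a path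
  with two edges, so any two edges are congruent modulo \<open>W\<close> and \<open>W\<close> has at most two cosets,
  represented by the empty graph and an edge.  Every transitive tournament stays transitive when
  its lowest edge is reversed, so some transitive tournament is reachable.

  If \<open>p\<close> is odd, all degrees in \<open>W\<close> are even, so inversions preserve the parities of the
  out-degrees; in a transitive tournament these degrees are \<open>0, \<dots>, n - 1\<close>.  Conversely, modulo
  4-cycles all triangles through a vertex are congruent, so each graph with even degrees is
  congruent to the empty graph or to a given triangle.  Choose a transitive tournament with the
  given parities; reversing its lowest triangle keeps it transitive.
\<close>

section \<open>Symmetric differences\<close>

definition sdiff :: "'a set \<Rightarrow> 'a set \<Rightarrow> 'a set" (infixl \<open>\<triangle>\<close> 65) where
  "A \<triangle> B = (A - B) \<union> (B - A)"

lemma mem_sdiff [simp]: "x \<in> A \<triangle> B \<longleftrightarrow> (x \<in> A) \<noteq> (x \<in> B)"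
  by (auto simp: sdiff_def)

lemma sdiff_assoc: "(A \<triangle> B) \<triangle> C = A \<triangle> (B \<triangle> C)"
  and sdiff_commute: "A \<triangle> B = B \<triangle> A"
  and sdiff_left_commute: "A \<triangle> (B \<triangle> C) = B \<triangle> (A \<triangle> C)"
  and sdiff_cancel [simp]: "A \<triangle> A = {}" "A \<triangle> (A \<triangle> B) = B" "A \<triangle> {} = A" "{} \<triangle> A = A"
  by (auto simp: set_eq_iff)

lemmas sdiff_ac = sdiff_assoc sdiff_commute sdiff_left_commute

lemma finite_sdiff [simp]: "finite A \<Longrightarrow> finite B \<Longrightarrow> finite (A \<triangle> B)"
  by (simp add: sdiff_def)

lemma even_card_sdiff:
  assumes "finite A" "finite B"
  shows "even (card (A \<triangle> B)) \<longleftrightarrow> (even (card A) \<longleftrightarrow> even (card B))"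
proof -
  have "card A = card (A - B) + card (A \<inter> B)" "card B = card (B - A) + card (A \<inter> B)"
    using assms card_Int_Diff[of A B] card_Int_Diff[of B A] by (simp_all add: Int_commute)
  moreover have "card (A \<triangle> B) = card (A - B) + card (B - A)"
    unfolding sdiff_def using assms by (intro card_Un_disjoint) auto
  ultimately show ?thesis by auto
qed

lemma Image_sdiff_singleton: "(A \<triangle> B) `` {v} = A `` {v} \<triangle> B `` {v}"
  by auto

section \<open>The span of the cliques\<close>

text \<open>Undirected graphs are symmetric irreflexive relations, so adding a clique to the arc set
  of a tournament swaps each arc inside it with its reverse.\<close>

definition clique :: "'a set \<Rightarrow> 'a rel" where
  "clique X = X \<times> X - Id"

lemma mem_clique [simp]: "(u, v) \<in> clique X \<longleftrightarrow> u \<in> X \<and> v \<in> X \<and> u \<noteq> v"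
  by (auto simp: clique_def)

inductive_set clique_span :: "nat \<Rightarrow> 'a set \<Rightarrow> 'a rel set" for p V where
  empty: "{} \<in> clique_span p V"
| insert: "G \<in> clique_span p V \<Longrightarrow> X \<subseteq> V \<Longrightarrow> card X = p \<Longrightarrow> clique X \<triangle> G \<in> clique_span p V"

lemma clique_span_sdiff:
  assumes "G \<in> clique_span p V" "H \<in> clique_span p V"
  shows "G \<triangle> H \<in> clique_span p V"
  using assms by induction (auto simp: sdiff_assoc intro: clique_span.intros)

lemma clique_in_span: "X \<subseteq> V \<Longrightarrow> card X = p \<Longrightarrow> clique X \<in> clique_span p V"
  using clique_span.insert[OF clique_span.empty] by fastforce

text \<open>Each vertex of a \<open>p\<close>-clique has \<open>p - 1\<close> neighbours in it, and
  parities of degrees add under \<open>\<triangle>\<close>.\<close>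

lemma clique_span_degree_even:
  assumes "G \<in> clique_span p V" "finite V" "odd p"
  shows "finite (G `` {v}) \<and> even (card (G `` {v}))"
  using assms
proof induction
  case (insert G X)
  have fin: "finite X" using insert.hyps insert.prems finite_subset by blast
  have "clique X `` {v} = (if v \<in> X then X - {v} else {})"
    by (auto simp: clique_def)
  then have "finite (clique X `` {v}) \<and> even (card (clique X `` {v}))"
    using insert.hyps insert.prems fin by simp
  then show ?case
    using insert by (simp add: Image_sdiff_singleton even_card_sdiff)
qed simp

text \<open>For disjoint sets this is the complete bipartite graph:
  \<open>join {a, b} {c, d}\<close> is a 4-cycle and \<open>join {a, b} {c}\<close> a path with
  middle \<open>c\<close>.\<close>

definition join :: "'a set \<Rightarrow> 'a set \<Rightarrow> 'a rel" where
  "join A B = A \<times> B \<union> B \<times> A"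

locale clique_span_large =
  fixes p :: nat and V :: "'a set"
  assumes finite_V: "finite V" and p_ge: "2 \<le> p" and card_V: "p + 2 \<le> card V"
begin

abbreviation W where "W \<equiv> clique_span p V"

text \<open>The cliques on \<open>insert a Z\<close> and \<open>insert b Z\<close> share exactly the
  edges inside \<open>Z\<close>, and these cancel.\<close>

lemma join_pair_in_span:
  assumes "a \<in> V" "b \<in> V" "a \<noteq> b" "Z \<subseteq> V - {a, b}" "card Z = p - 1"
  shows "join {a, b} Z \<in> W"
proof -
  have fin: "finite Z" using assms finite_V finite_subset by blast
  have "clique (insert a Z) \<triangle> clique (insert b Z) \<in> W"
    using assms fin p_ge by (intro clique_span_sdiff clique_in_span) (auto simp: card_insert_if)
  also have "clique (insert a Z) \<triangle> clique (insert b Z) = join {a, b} Z"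
    using assms by (auto simp: join_def)
  finally show ?thesis .
qed

lemma join_sdiff: "A \<inter> B = {} \<Longrightarrow> A \<inter> C = {} \<Longrightarrow> join A B \<triangle> join A C = join A (B \<triangle> C)"
  by (auto simp: join_def)

lemma four_cycle_in_span:
  assumes "a \<in> V" "b \<in> V" "c \<in> V" "d \<in> V" "distinct [a, b, c, d]"
  shows "join {a, b} {c, d} \<in> W"
proof -
  \<comment> \<open>The bound \<open>p + 2 \<le> card V\<close> leaves room for a common part
    \<open>R\<close>, which cancels between the two joins below.\<close>
  have "p - 2 \<le> card (V - {a, b, c, d})"
    using assms finite_V card_V by (simp add: card_Diff_subset)
  then obtain R where R: "R \<subseteq> V - {a, b, c, d}" "card R = p - 2" "finite R"
    using obtain_subset_with_card_n by metis
  have "join {a, b} (insert c R) \<triangle> join {a, b} (insert d R) \<in> W"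
    using assms R p_ge by (intro clique_span_sdiff join_pair_in_span) (auto simp: card_insert_if)
  also have "join {a, b} (insert c R) \<triangle> join {a, b} (insert d R)
      = join {a, b} (insert c R \<triangle> insert d R)"
    using assms R by (intro join_sdiff) auto
  also have "insert c R \<triangle> insert d R = {c, d}"
    using assms R by auto
  finally show ?thesis .
qed

text \<open>Split \<open>Z\<close> into pairs; each pair contributes a 4-cycle.\<close>

lemma join_even_in_span:
  assumes "a \<in> V" "b \<in> V" "a \<noteq> b" "Z \<subseteq> V - {a, b}" "even (card Z)"
  shows "join {a, b} Z \<in> W"
  using assms(4,5)
proof (induction "card Z" arbitrary: Z rule: less_induct)
  case less
  have fin: "finite Z" using less.prems finite_V finite_subset by blast
  show ?case
  proof (cases "Z = {}")
    case True
    then show ?thesis by (simp add: join_def clique_span.empty)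
  next
    case False
    then have "card Z \<ge> 2" using less.prems fin
      by (metis One_nat_def Suc_1 Suc_leI card_gt_0_iff le_neq_implies_less odd_one)
    then obtain S where "S \<subseteq> Z" "card S = 2" by (metis obtain_subset_with_card_n)
    then obtain c d where cd: "c \<in> Z" "d \<in> Z" "c \<noteq> d"
      by (auto simp: card_2_iff)
    have card: "card (Z - {c, d}) = card Z - 2"
      using cd fin by (simp add: card_Diff_subset)
    have "join {a, b} {c, d} \<triangle> join {a, b} (Z - {c, d}) \<in> W"
    proof (rule clique_span_sdiff)
      show "join {a, b} {c, d} \<in> W"
        using cd less.prems assms by (intro four_cycle_in_span) auto
      show "join {a, b} (Z - {c, d}) \<in> W"
        using less.hyps[of "Z - {c, d}"] card \<open>card Z \<ge> 2\<close> less.prems by auto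
    qed
    also have "join {a, b} {c, d} \<triangle> join {a, b} (Z - {c, d}) = join {a, b} ({c, d} \<triangle> (Z - {c, d}))"
      using cd less.prems by (intro join_sdiff) auto
    also have "{c, d} \<triangle> (Z - {c, d}) = Z" using cd by auto
    finally show ?thesis .
  qed
qed

text \<open>For even \<open>p\<close> the \<open>p - 2\<close> vertices of \<open>R\<close> are even
  in number, so their join with \<open>{a, b}\<close> can be removed from that of the
  \<open>p - 1\<close> vertices \<open>insert c R\<close>.\<close>

lemma two_path_in_span:
  assumes "even p" "a \<in> V" "b \<in> V" "c \<in> V" "distinct [a, b, c]"
  shows "join {a, b} {c} \<in> W"
proof -
  have "p - 2 \<le> card (V - {a, b, c})"
    using assms finite_V card_V by (simp add: card_Diff_subset)
  then obtain R where R: "R \<subseteq> V - {a, b, c}" "card R = p - 2" "finite R"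
    using obtain_subset_with_card_n by metis
  have "join {a, b} (insert c R) \<triangle> join {a, b} R \<in> W"
    using assms R p_ge
    by (intro clique_span_sdiff join_pair_in_span join_even_in_span) (auto simp: card_insert_if)
  also have "join {a, b} (insert c R) \<triangle> join {a, b} R = join {a, b} (insert c R \<triangle> R)"
    using assms R by (intro join_sdiff) auto
  also have "insert c R \<triangle> R = {c}" using R by auto
  finally show ?thesis .
qed

section \<open>Congruence of edges and of triangles modulo the span\<close>

lemma edges_equivalent:
  assumes "even p" "u \<in> V" "v \<in> V" "x \<in> V" "y \<in> V" "u \<noteq> v" "x \<noteq> y"
  shows "clique {u, v} \<triangle> clique {x, y} \<in> W"
proof -
  have share: "clique {a, b} \<triangle> clique {a, c} \<in> W"
    if "a \<in> V" "b \<in> V" "c \<in> V" "a \<noteq> b" "a \<noteq> c" for a b c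
  proof (cases "b = c")
    case False
    have "clique {a, b} \<triangle> clique {a, c} = join {b, c} {a}"
      using that False by (auto simp: join_def)
    then show ?thesis using two_path_in_span[of b c a] that False assms(1) by auto
  qed (simp add: clique_span.empty)
  show ?thesis
  proof (cases "u = x")
    case False
    \<comment> \<open>The edge \<open>ux\<close> meets both given edges and serves as an
      intermediate; its two copies cancel.\<close>
    have "(clique {u, v} \<triangle> clique {u, x}) \<triangle> (clique {x, u} \<triangle> clique {x, y}) \<in> W"
      using share assms False by (intro clique_span_sdiff[of "_ \<triangle> _"]) auto
    then show ?thesis by (simp add: sdiff_assoc insert_commute)
  qed (use share assms in auto)
qed

text \<open>Distinct triangles sharing the edge \<open>ra\<close> differ by a 4-cycle; the triangle
  \<open>{r, u, x}\<close> links the general pair.\<close>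

lemma triangles_equivalent:
  assumes "r \<in> V" "u \<in> V" "v \<in> V" "x \<in> V" "y \<in> V" "distinct [r, u, v]" "distinct [r, x, y]"
  shows "clique {r, u, v} \<triangle> clique {r, x, y} \<in> W"
proof -
  have share: "clique {r, a, b} \<triangle> clique {r, a, c} \<in> W"
    if "a \<in> V" "b \<in> V" "c \<in> V" "distinct [r, a, b]" "distinct [r, a, c]" for a b c
  proof (cases "b = c")
    case False
    have "clique {r, a, b} \<triangle> clique {r, a, c} = join {b, c} {r, a}"
      using that False by (auto simp: join_def)
    then show ?thesis using four_cycle_in_span[of b c r a] that False assms(1) by auto
  qed (simp add: clique_span.empty)
  show ?thesis
  proof (cases "u = x")
    case False
    have "(clique {r, u, v} \<triangle> clique {r, u, x}) \<triangle> (clique {r, x, u} \<triangle> clique {r, x, y}) \<in> W"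
      using share assms False by (intro clique_span_sdiff[of "_ \<triangle> _"]) auto
    then show ?thesis by (simp add: sdiff_assoc insert_commute)
  qed (use share assms in auto)
qed

text \<open>Adding \<open>S \<triangle> E\<close> exchanges the two alternatives, so a piece
  \<open>S\<close> congruent to \<open>E\<close> may be added to \<open>G\<close> in the inductions
  below.\<close>

lemma span_or_translate_step:
  assumes "G \<triangle> S \<in> W \<or> G \<triangle> S \<triangle> E \<in> W" "S \<triangle> E \<in> W"
  shows "G \<in> W \<or> G \<triangle> E \<in> W"
proof -
  have "(G \<triangle> S) \<triangle> (S \<triangle> E) = G \<triangle> E" "(G \<triangle> S \<triangle> E) \<triangle> (S \<triangle> E) = G"
    by (auto simp: sdiff_ac)
  then show ?thesis using assms clique_span_sdiff by metis
qed

text \<open>Edges are removed one by one; each is congruent to \<open>xy\<close>, so only the parity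
  of their number matters.\<close>

lemma even_span_or_translate:
  assumes "even p" "x \<in> V" "y \<in> V" "x \<noteq> y"
    and "G \<subseteq> V \<times> V" "sym G" "irrefl G"
  shows "G \<in> W \<or> G \<triangle> clique {x, y} \<in> W"
  using assms(5-)
proof (induction "card G" arbitrary: G rule: less_induct)
  case less
  have fin: "finite G" using less.prems finite_V finite_subset by blast
  show ?case
  proof (cases "G = {}")
    case False
    then obtain u v where uv: "(u, v) \<in> G" by auto
    then have vu: "(v, u) \<in> G" and ne: "u \<noteq> v" and V: "u \<in> V" "v \<in> V"
      using less.prems by (auto dest: symD irreflD)
    have eq: "G \<triangle> clique {u, v} = G - {(u, v), (v, u)}" using uv vu ne by auto
    show ?thesis
    proof (rule span_or_translate_step)
      show "G \<triangle> clique {u, v} \<in> W \<or> G \<triangle> clique {u, v} \<triangle> clique {x, y} \<in> W"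
      proof (rule less.hyps)
        show "card (G \<triangle> clique {u, v}) < card G"
          unfolding eq using uv fin by (intro psubset_card_mono) auto
        show "sym (G \<triangle> clique {u, v})" "irrefl (G \<triangle> clique {u, v})"
          "G \<triangle> clique {u, v} \<subseteq> V \<times> V"
          unfolding eq using less.prems by (auto simp: sym_def irrefl_def)
      qed
      show "clique {u, v} \<triangle> clique {x, y} \<in> W"
        using edges_equivalent assms V ne by auto
    qed
  qed (simp add: clique_span.empty)
qed

text \<open>Adding the triangle through \<open>r\<close> on every edge avoiding \<open>r\<close> leaves a star centred
  at \<open>r\<close>; having even degrees, it is empty.\<close>

lemma even_degree_span_or_translate:
  assumes "r \<in> V" "x \<in> V" "y \<in> V" "distinct [r, x, y]"
    and "G \<subseteq> V \<times> V" "sym G" "irrefl G" "\<And>v. even (card (G `` {v}))"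
  shows "G \<in> W \<or> G \<triangle> clique {r, x, y} \<in> W"
  using assms(5-)
\<comment> \<open>The measure ignores edges at \<open>r\<close>, since adding a triangle may create
  some there.\<close>
proof (induction "card (G \<inter> (V - {r}) \<times> (V - {r}))" arbitrary: G rule: less_induct)
  case less
  have fin: "finite G" using less.prems finite_V finite_subset by blast
  show ?case
  proof (cases "G \<inter> (V - {r}) \<times> (V - {r}) = {}")
    case True
    have "G = {}"
    proof (rule ccontr)
      assume "G \<noteq> {}"
      then obtain u v where uv: "(u, v) \<in> G" by auto
      then have vu: "(v, u) \<in> G" and ne: "u \<noteq> v" and V: "u \<in> V" "v \<in> V"
        using less.prems by (auto dest: symD irreflD)
      \<comment> \<open>Every edge meets \<open>r\<close>, so \<open>w\<close> is the endpoint of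
        \<open>uv\<close> other than \<open>r\<close>; its degree would be 1.\<close>
      obtain w where w: "(w, r) \<in> G" "w \<noteq> r"
        using True uv vu ne V by auto
      have "G `` {w} = {r}"
        using w True less.prems(1) by auto
      then show False using less.prems(4)[of w] by simp
    qed
    then show ?thesis by (simp add: clique_span.empty)
  next
    case False
    then obtain u v where uv: "(u, v) \<in> G" and r: "u \<noteq> r" "v \<noteq> r" by auto
    then have vu: "(v, u) \<in> G" and ne: "u \<noteq> v" and V: "u \<in> V" "v \<in> V"
      using less.prems by (auto dest: symD irreflD)
    show ?thesis
    proof (rule span_or_translate_step)
      let ?G = "G \<triangle> clique {r, u, v}"
      show "?G \<in> W \<or> ?G \<triangle> clique {r, x, y} \<in> W"
      proof (rule less.hyps)
        have less: "?G \<inter> (V - {r}) \<times> (V - {r}) = G \<inter> (V - {r}) \<times> (V - {r}) - {(u, v), (v, u)}"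
          using uv vu r ne by (auto simp: set_eq_iff)
        show "card (?G \<inter> (V - {r}) \<times> (V - {r})) < card (G \<inter> (V - {r}) \<times> (V - {r}))"
          unfolding less by (rule psubset_card_mono) (use uv fin r V in blast)+
        show "sym ?G"
          using less.prems(2) by (auto simp: sym_def)
        show "irrefl ?G"
          using less.prems(3) by (auto simp: irrefl_def)
        show "?G \<subseteq> V \<times> V"
          using less.prems(1) V assms(1) by (auto simp: clique_def)
        fix w
        have "clique {r, u, v} `` {w} = (if w \<in> {r, u, v} then {r, u, v} - {w} else {})"
          by (auto simp: clique_def)
        then have "even (card (clique {r, u, v} `` {w}))" "finite (clique {r, u, v} `` {w})"
          using r ne by (auto simp: card_Diff_singleton_if card_insert_if)
        then show "even (card (?G `` {w}))"
          using less.prems(4)[of w] fin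
          by (simp add: Image_sdiff_singleton even_card_sdiff finite_Image)
      qed
      show "clique {r, u, v} \<triangle> clique {r, x, y} \<in> W"
        using triangles_equivalent assms V ne r by auto
    qed
  qed
qed

end

section \<open>Tournaments as arc sets\<close>

definition tournament_on :: "'a set \<Rightarrow> 'a rel \<Rightarrow> bool" where
  "tournament_on V A \<longleftrightarrow> A \<subseteq> V \<times> V \<and> (\<forall>u. (u, u) \<notin> A) \<and>
    (\<forall>u\<in>V. \<forall>v\<in>V. u \<noteq> v \<longrightarrow> ((u, v) \<in> A \<longleftrightarrow> (v, u) \<notin> A))"

lemma tournament_onI:
  assumes "\<And>u v. (u, v) \<in> A \<Longrightarrow> u \<in> V \<and> v \<in> V \<and> u \<noteq> v"
    and "\<And>u v. u \<in> V \<Longrightarrow> v \<in> V \<Longrightarrow> u \<noteq> v \<Longrightarrow> (u, v) \<in> A \<longleftrightarrow> (v, u) \<notin> A"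
  shows "tournament_on V A"
  unfolding tournament_on_def
proof (intro conjI allI ballI impI)
  show "A \<subseteq> V \<times> V" using assms(1) by auto
  show "(u, u) \<notin> A" for u using assms(1)[of u u] by auto
qed (rule assms(2))

lemma tournament_on_arcD: "tournament_on V A \<Longrightarrow> (u, v) \<in> A \<Longrightarrow> u \<in> V \<and> v \<in> V \<and> u \<noteq> v"
  unfolding tournament_on_def by blast

lemma tournament_on_flip:
  "tournament_on V A \<Longrightarrow> u \<in> V \<Longrightarrow> v \<in> V \<Longrightarrow> u \<noteq> v \<Longrightarrow> (u, v) \<in> A \<longleftrightarrow> (v, u) \<notin> A"
  unfolding tournament_on_def by blast

lemma tournament_on_finite_Image: "tournament_on V A \<Longrightarrow> finite V \<Longrightarrow> finite (A `` {v})"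
  by (rule finite_subset[of _ V]) (auto dest: tournament_on_arcD)

lemma tournament_parcs:
  assumes "tournament T"
  shows "tournament_on (pverts T) (parcs T)"
proof -
  interpret tournament T by fact
  show ?thesis
    unfolding tournament_on_def using adjacent no_antiparallel pair_no_loops in_arcsD1 in_arcsD2
    by fastforce
qed

lemma tournament_on_sdiff_clique:
  assumes "tournament_on V A" "X \<subseteq> V"
  shows "tournament_on V (A \<triangle> clique X)"
proof (rule tournament_onI)
  show "u \<in> V \<and> v \<in> V \<and> u \<noteq> v" if "(u, v) \<in> A \<triangle> clique X" for u v
    using that assms by (auto dest: tournament_on_arcD)
  show "(u, v) \<in> A \<triangle> clique X \<longleftrightarrow> (v, u) \<notin> A \<triangle> clique X"
    if "u \<in> V" "v \<in> V" "u \<noteq> v" for u v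
    using tournament_on_flip[OF assms(1) that] that by auto
qed

section \<open>Inversions as symmetric differences\<close>

lemma pverts_invert [simp]: "pverts (invert D X) = pverts D"
  by (simp add: invert_def)

text \<open>Exactly one of \<open>(u, v)\<close> and \<open>(v, u)\<close> is an arc for distinct
  \<open>u\<close>, \<open>v\<close> in \<open>X\<close>, so swapping them is complementing
  membership.\<close>

lemma parcs_invert:
  assumes "tournament_on V (parcs D)" "X \<subseteq> V"
  shows "parcs (invert D X) = parcs D \<triangle> clique X"
proof -
  have "(u, v) \<in> parcs (invert D X) \<longleftrightarrow> (u, v) \<in> parcs D \<triangle> clique X" for u v
  proof -
    have "(u, v) \<in> parcs (invert D X) \<longleftrightarrow>
        (if u \<in> X \<and> v \<in> X then (v, u) \<in> parcs D else (u, v) \<in> parcs D)"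
      by (auto simp: invert_def)
    moreover have "(u, v) \<in> parcs D \<longleftrightarrow> (v, u) \<notin> parcs D" if "u \<in> X" "v \<in> X" "u \<noteq> v"
      using assms that by (meson subsetD tournament_on_flip)
    ultimately show ?thesis by auto
  qed
  then show ?thesis by auto
qed

text \<open>The tournament property is carried along because \<open>parcs_invert\<close> needs it at
  each inversion.\<close>

lemma parcs_foldl_invert:
  assumes "tournament_on (pverts D) (parcs D)" "\<forall>X\<in>set Xs. X \<subseteq> pverts D \<and> card X = p"
  shows "pverts (foldl invert D Xs) = pverts D \<and>
    tournament_on (pverts D) (parcs (foldl invert D Xs)) \<and>
    (\<exists>G\<in>clique_span p (pverts D). parcs (foldl invert D Xs) = parcs D \<triangle> G)"
  using assms
proof (induction Xs arbitrary: D)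
  case Nil
  then show ?case by (auto intro: bexI[OF _ clique_span.empty])
next
  case (Cons X Xs)
  have arcs: "parcs (invert D X) = parcs D \<triangle> clique X"
    using Cons.prems by (intro parcs_invert) auto
  have "tournament_on (pverts D) (parcs (invert D X))"
    using Cons.prems by (auto simp: arcs tournament_on_sdiff_clique)
  from Cons.IH[of "invert D X"] this obtain G where
    "pverts (foldl invert (invert D X) Xs) = pverts D"
    "tournament_on (pverts D) (parcs (foldl invert (invert D X) Xs))"
    "G \<in> clique_span p (pverts D)" "parcs (foldl invert (invert D X) Xs) = parcs D \<triangle> clique X \<triangle> G"
    using Cons.prems arcs by auto
  then show ?case
    using Cons.prems
    by (auto simp: sdiff_assoc intro!: bexI[of _ "clique X \<triangle> G"] clique_span.insert)
qed

text \<open>Converse of the preceding lemma: every summand of \<open>G\<close> is appended as one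
  more inverted set.\<close>

lemma clique_span_realised:
  assumes "G \<in> clique_span p (pverts D)" "tournament_on (pverts D) (parcs D)"
  shows "\<exists>Xs. (\<forall>X\<in>set Xs. X \<subseteq> pverts D \<and> card X = p) \<and> parcs (foldl invert D Xs) = parcs D \<triangle> G"
  using assms
proof (induction rule: clique_span.induct)
  case empty
  show ?case by (intro exI[of _ "[]"]) simp
next
  case (insert G X)
  then obtain Xs where Xs: "\<forall>X\<in>set Xs. X \<subseteq> pverts D \<and> card X = p"
    "parcs (foldl invert D Xs) = parcs D \<triangle> G" by auto
  have "parcs (invert (foldl invert D Xs) X) = parcs (foldl invert D Xs) \<triangle> clique X"
    using parcs_foldl_invert[OF insert.prems Xs(1)] insert.hyps by (intro parcs_invert) auto
  then show ?case
    using Xs insert.hyps by (intro exI[of _ "Xs @ [X]"]) (auto simp: sdiff_ac)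
qed

text \<open>Nonempty closed walks are the loops of the transitive closure, and each contains a
  cycle.\<close>

lemma acyclic_digraph_iff:
  assumes "parcs D \<subseteq> pverts D \<times> pverts D"
  shows "acyclic_digraph D \<longleftrightarrow> acyclic (parcs D)"
proof -
  interpret pair_wf_digraph D by unfold_locales (use assms in auto)
  have "(\<exists>c. cycle c) \<longleftrightarrow> (\<exists>u. (u, u) \<in> (parcs D)\<^sup>+)"
    using closed_w_imp_cycle by (force simp: reachable1_awalk cycle_conv closed_w_def)
  then show ?thesis
    by (auto simp: acyclic_digraph_def acyclic_def)
qed

lemma eq_invertible_iff:
  assumes "tournament T"
  shows "eq_invertible p T \<longleftrightarrow> (\<exists>G\<in>clique_span p (pverts T). acyclic (parcs T \<triangle> G))"
proof -
  note tourn = tournament_parcs[OF assms]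
  have iff: "acyclic_digraph (foldl invert T Xs) \<longleftrightarrow> acyclic (parcs (foldl invert T Xs))"
    if "\<forall>X\<in>set Xs. X \<subseteq> pverts T \<and> card X = p" for Xs
    using parcs_foldl_invert[OF tourn that]
    by (intro acyclic_digraph_iff) (simp add: tournament_on_def)
  show ?thesis
  proof
    assume "eq_invertible p T"
    then show "\<exists>G\<in>clique_span p (pverts T). acyclic (parcs T \<triangle> G)"
      unfolding eq_invertible_def using iff parcs_foldl_invert[OF tourn] by metis
  next
    assume "\<exists>G\<in>clique_span p (pverts T). acyclic (parcs T \<triangle> G)"
    then show "eq_invertible p T"
      unfolding eq_invertible_def using iff clique_span_realised[OF _ tourn] by metis
  qed
qed

lemma out_degree_with_proj: "out_degree (with_proj T) v = card (parcs T `` {v})"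
proof -
  have "out_arcs (with_proj T) v = Pair v ` (parcs T `` {v})"
    by (auto simp: out_arcs_def)
  then show ?thesis
    by (simp add: out_degree_def card_image inj_on_def)
qed

section \<open>Transitive tournaments\<close>

lemma tournament_on_sdiff_span:
  assumes "G \<in> clique_span p V" "tournament_on V A"
  shows "tournament_on V (A \<triangle> G)"
  using assms
proof induction
  case (insert G X)
  then show ?case
    using tournament_on_sdiff_clique[of V "A \<triangle> G" X] by (simp add: sdiff_ac)
qed simp

text \<open>Acyclicity forces transitivity, so along an arc the out-neighbourhood strictly shrinks.
  The out-degrees are thus distinct and below \<open>card V\<close>, and fill the range by
  counting.\<close>

lemma acyclic_tournament_degrees:
  assumes "tournament_on V A" "finite V" "acyclic A"
  shows "bij_betw (\<lambda>v. card (A `` {v})) V {..<card V}"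
proof -
  have fin: "finite (A `` {v})" for v
    using assms by (simp add: tournament_on_finite_Image)
  have trans: "(u, w) \<in> A" if "(u, v) \<in> A" "(v, w) \<in> A" for u v w
  proof (rule ccontr)
    assume "(u, w) \<notin> A"
    moreover have "(u, w) \<in> A\<^sup>+" using that by (meson r_into_trancl' trancl.trancl_into_trancl)
    then have "u \<noteq> w" using assms(3) by (auto simp: acyclic_def)
    moreover have "u \<in> V" "w \<in> V" using that tournament_on_arcD[OF assms(1)] by blast+
    ultimately have "(w, u) \<in> A" using tournament_on_flip[OF assms(1)] by blast
    then have "(u, u) \<in> A\<^sup>+" using \<open>(u, w) \<in> A\<^sup>+\<close> by (rule trancl.trancl_into_trancl[rotated])
    then show False using assms(3) by (auto simp: acyclic_def)
  qed
  have less: "card (A `` {v}) < card (A `` {u})" if "(u, v) \<in> A" for u v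
  proof (rule psubset_card_mono[OF fin])
    have "(v, v) \<notin> A" using assms(1) by (simp add: tournament_on_def)
    then show "A `` {v} \<subset> A `` {u}" using trans that by blast
  qed
  have inj: "inj_on (\<lambda>v. card (A `` {v})) V"
  proof (rule inj_onI, rule ccontr)
    fix u v assume "u \<in> V" "v \<in> V" "card (A `` {u}) = card (A `` {v})" "u \<noteq> v"
    then show False
      using less[of u v] less[of v u] tournament_on_flip[OF assms(1)] by (metis less_irrefl)
  qed
  have sub: "(\<lambda>v. card (A `` {v})) ` V \<subseteq> {..<card V}"
  proof
    fix k assume "k \<in> (\<lambda>v. card (A `` {v})) ` V"
    then obtain v where v: "v \<in> V" "k = card (A `` {v})" by auto
    have "A `` {v} \<subset> V" using v tournament_on_arcD[OF assms(1)] by blast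
    then show "k \<in> {..<card V}" using v assms(2) psubset_card_mono by auto
  qed
  show ?thesis
    unfolding bij_betw_def using inj sub
    by (simp add: card_image card_subset_eq)
qed

text \<open>Source of the ceiling in the theorem: 0 is even, so the count rounds up.\<close>

lemma card_even_lessThan: "card {k \<in> {..<n}. even k} = (n + 1) div 2"
proof (induction n)
  case (Suc n)
  have "{k \<in> {..<Suc n}. even k} = (if even n then insert n else id) {k \<in> {..<n}. even k}"
    by (auto simp: less_Suc_eq)
  then show ?case using Suc by (auto elim!: evenE oddE)
qed simp

lemma card_odd_lessThan: "card {k \<in> {..<n}. odd k} = n div 2"
proof (induction n)
  case (Suc n)
  have "{k \<in> {..<Suc n}. odd k} = (if odd n then insert n else id) {k \<in> {..<n}. odd k}"
    by (auto simp: less_Suc_eq)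
  then show ?case using Suc by (auto elim!: evenE oddE)
qed simp

lemma acyclic_tournament_card_even_degrees:
  assumes "tournament_on V A" "finite V" "acyclic A"
  shows "card {v \<in> V. even (card (A `` {v}))} = (card V + 1) div 2"
proof -
  have "bij_betw (\<lambda>v. card (A `` {v})) {v \<in> V. even (card (A `` {v}))} {k \<in> {..<card V}. even k}"
    using acyclic_tournament_degrees[OF assms] unfolding bij_betw_def
    by (auto intro: inj_on_subset)
  from bij_betw_same_card[OF this] show ?thesis
    by (simp only: card_even_lessThan)
qed

section \<open>Transitive tournaments from rankings\<close>

definition ranked :: "'a set \<Rightarrow> ('a \<Rightarrow> nat) \<Rightarrow> 'a rel" where
  "ranked V f = {(u, v). u \<in> V \<and> v \<in> V \<and> f v < f u}"

lemma acyclic_ranked: "acyclic (ranked V f)"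
proof -
  have "f v < f u" if "(u, v) \<in> (ranked V f)\<^sup>+" for u v
    using that by induction (auto simp: ranked_def)
  then show ?thesis by (fastforce simp: acyclic_def)
qed

lemma tournament_on_ranked: "inj_on f V \<Longrightarrow> tournament_on V (ranked V f)"
  by (rule tournament_onI) (auto simp: ranked_def not_less le_less dest: inj_onD)

text \<open>The out-neighbours of \<open>v\<close> correspond to the values below
  \<open>f v\<close>, all of which are attained; so a ranking prescribes the out-degrees.\<close>

lemma card_ranked_Image:
  assumes "bij_betw f V {..<n}" "v \<in> V"
  shows "card (ranked V f `` {v}) = f v"
proof -
  have "f v < n" using assms by (auto simp: bij_betw_def)
  have "bij_betw f (ranked V f `` {v}) {..<f v}"
  proof (rule bij_betw_imageI)
    show "inj_on f (ranked V f `` {v})"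
      using assms by (auto simp: bij_betw_def inj_on_def ranked_def)
    have "k \<in> f ` (ranked V f `` {v})" if "k < f v" for k
    proof -
      have "k \<in> f ` V" using that \<open>f v < n\<close> assms by (auto simp: bij_betw_def)
      then show ?thesis using that assms by (auto simp: ranked_def)
    qed
    then show "f ` (ranked V f `` {v}) = {..<f v}"
      by (auto simp: ranked_def)
  qed
  then show ?thesis using bij_betw_same_card by fastforce
qed

text \<open>Replacing \<open>f v\<close> by \<open>k - f v\<close> reflects the values up to
  \<open>k\<close> among themselves, which reverses exactly the arcs between the lowest
  vertices.\<close>

lemma ranked_sdiff_bottom_clique:
  assumes "inj_on f V"
  shows "ranked V f \<triangle> clique {v \<in> V. f v \<le> k} = ranked V (\<lambda>v. if f v \<le> k then k - f v else f v)"
proof -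
  have "(u, v) \<in> ranked V f \<triangle> clique {v \<in> V. f v \<le> k} \<longleftrightarrow>
    (u, v) \<in> ranked V (\<lambda>v. if f v \<le> k then k - f v else f v)" for u v
    using inj_onD[OF assms, of u v] by (cases "f u" "f v" rule: linorder_cases) (auto simp: ranked_def)
  then show ?thesis by auto
qed

text \<open>Two tournaments differ in whole edges, so their difference is a graph to which the span
  lemmas apply.\<close>

lemma tournament_on_sdiff:
  assumes "tournament_on V A" "tournament_on V B"
  shows "A \<triangle> B \<subseteq> V \<times> V" "sym (A \<triangle> B)" "irrefl (A \<triangle> B)"
proof -
  show "A \<triangle> B \<subseteq> V \<times> V" "irrefl (A \<triangle> B)"
    using assms by (auto simp: irrefl_def dest: tournament_on_arcD)
  have "(v, u) \<in> A \<triangle> B" if "(u, v) \<in> A \<triangle> B" for u v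
  proof -
    have V: "u \<in> V" "v \<in> V" "u \<noteq> v" using that assms by (auto dest: tournament_on_arcD)
    show ?thesis
      using that tournament_on_flip[OF assms(1) V] tournament_on_flip[OF assms(2) V] by auto
  qed
  then show "sym (A \<triangle> B)" by (auto intro: symI)
qed

text \<open>Reversing the lowest \<open>k + 1\<close> vertices of a ranking gives a second acyclic target,
  so it is enough to reach one of the two.\<close>

lemma acyclic_reachable:
  assumes "inj_on f V"
    and "A \<triangle> ranked V f \<in> clique_span p V \<or>
      A \<triangle> ranked V f \<triangle> clique {v \<in> V. f v \<le> k} \<in> clique_span p V"
  shows "\<exists>G\<in>clique_span p V. acyclic (A \<triangle> G)"
  using assms(2)
proof
  assume "A \<triangle> ranked V f \<in> clique_span p V"
  then show ?thesis by (rule bexI[rotated]) (simp add: acyclic_ranked)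
next
  assume "A \<triangle> ranked V f \<triangle> clique {v \<in> V. f v \<le> k} \<in> clique_span p V"
  then show ?thesis
    by (rule bexI[rotated])
      (simp add: sdiff_assoc ranked_sdiff_bottom_clique[OF assms(1)] acyclic_ranked)
qed

text \<open>By the count, the vertices with \<open>P\<close> match the even values below
  \<open>card V\<close>; the others then match the odd ones, and the two bijections are
  glued.\<close>

lemma ranking_with_parity:
  assumes "finite V" "card {v \<in> V. P v} = (card V + 1) div 2"
  obtains f where "bij_betw f V {..<card V}" "\<And>v. v \<in> V \<Longrightarrow> even (f v) \<longleftrightarrow> P v"
proof -
  let ?E = "{v \<in> V. P v}" and ?O = "{v \<in> V. \<not> P v}"
  let ?e = "{k \<in> {..<card V}. even k}" and ?o = "{k \<in> {..<card V}. odd k}"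
  have split: "V = ?E \<union> ?O" "{..<card V} = ?e \<union> ?o" by auto
  have "card V = card ?E + card ?O"
    using assms(1) by (subst split(1), intro card_Un_disjoint) auto
  then have "card ?O = card ?o"
    using assms(2) card_odd_lessThan[of "card V"] by linarith
  moreover have "card ?E = card ?e"
    using assms(2) card_even_lessThan[of "card V"] by simp
  moreover have "finite ?E" "finite ?O" "finite ?e" "finite ?o" using assms(1) by auto
  ultimately obtain g h where g: "bij_betw g ?E ?e" and h: "bij_betw h ?O ?o"
    using finite_same_card_bij[of ?E ?e] finite_same_card_bij[of ?O ?o] by auto
  let ?f = "\<lambda>v. if P v then g v else h v"
  have "bij_betw ?f ?E ?e" using g by (subst bij_betw_cong[of _ _ g]) auto
  moreover have "bij_betw ?f ?O ?o" using h by (subst bij_betw_cong[of _ _ h]) auto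
  ultimately have "bij_betw ?f (?E \<union> ?O) (?e \<union> ?o)"
    by (rule bij_betw_combine) auto
  then have "bij_betw ?f V {..<card V}" using split by metis
  moreover have "even (?f v) \<longleftrightarrow> P v" if "v \<in> V" for v
    using g h that by (auto simp: bij_betw_def)
  ultimately show thesis using that by blast
qed

theorem theorem1p3:
  fixes p n :: nat and T :: "nat pair_pre_digraph"
  assumes "p \<ge> 2" and "n \<ge> p + 2"
    and "tournament T" and "pverts T = {1..n}"
  shows "eq_invertible p T \<longleftrightarrow>
    even p \<or> int (card {i \<in> {1..n}. even (out_degree (with_proj T) i)}) = \<lceil>real n / 2\<rceil>"
proof -
  define V where "V = {1..n}"
  define A where "A = parcs T"
  have V: "finite V" "card V = n" "pverts T = V" by (simp_all add: V_def assms)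
  interpret clique_span_large p V by unfold_locales (use V assms in auto)
  have A: "tournament_on V A" using tournament_parcs assms V by (metis A_def)
  have finA: "finite (A `` {v})" for v
    using A V by (simp add: tournament_on_finite_Image)
  have "\<lceil>real n / 2\<rceil> = int ((n + 1) div 2)"
    by (cases "even n") (auto elim!: evenE oddE simp: ceiling_eq_iff)
  then have count: "int (card {i \<in> {1..n}. even (out_degree (with_proj T) i)}) = \<lceil>real n / 2\<rceil>
      \<longleftrightarrow> card {v \<in> V. even (card (A `` {v}))} = (card V + 1) div 2"
    by (simp add: out_degree_with_proj A_def V_def)
  \<comment> \<open>Since \<open>n \<ge> 4\<close>, the lowest values needed for an edge or a
    triangle are attained.\<close>
  have bottom: "\<exists>v\<in>V. f v = k" if "bij_betw f V {..<n}" "k < 4" for f k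
  proof -
    have "k \<in> f ` V" using that assms by (auto simp: bij_betw_def)
    then show ?thesis by auto
  qed
  have "(\<exists>G\<in>W. acyclic (A \<triangle> G)) \<longleftrightarrow>
    even p \<or> card {v \<in> V. even (card (A `` {v}))} = (card V + 1) div 2"
  proof (intro iffI disj_imp[THEN iffD2] impI)
    assume "odd p"
    assume "\<exists>G\<in>W. acyclic (A \<triangle> G)"
    then obtain G where G: "G \<in> W" "acyclic (A \<triangle> G)" by auto
    \<comment> \<open>Elements of \<open>W\<close> have even degrees for odd \<open>p\<close>, so no
      out-degree changes parity.\<close>
    have "even (card ((A \<triangle> G) `` {v})) \<longleftrightarrow> even (card (A `` {v}))" for v
      using clique_span_degree_even[OF G(1) V(1) \<open>odd p\<close>, of v] finA
      by (simp add: Image_sdiff_singleton even_card_sdiff)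
    then show "card {v \<in> V. even (card (A `` {v}))} = (card V + 1) div 2"
      using acyclic_tournament_card_even_degrees[OF tournament_on_sdiff_span[OF G(1) A] V(1) G(2)]
      by simp
  next
    assume "even p \<or> card {v \<in> V. even (card (A `` {v}))} = (card V + 1) div 2"
    then show "\<exists>G\<in>W. acyclic (A \<triangle> G)"
    proof
      assume "even p"
      obtain f where f: "bij_betw f V {..<n}"
        using V by (metis card_lessThan finite_lessThan finite_same_card_bij)
      then have inj: "inj_on f V" by (simp add: bij_betw_def)
      obtain x y where xy: "x \<in> V" "f x = 0" "y \<in> V" "f y = 1"
        using bottom[OF f, of 0] bottom[OF f, of 1] by auto
      \<comment> \<open>The two lowest vertices span a single edge, the translate offered by
        \<open>even_span_or_translate\<close>.\<close>
      have "f v \<le> 1 \<longleftrightarrow> v = x \<or> v = y" if "v \<in> V" for v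
        using inj_on_eq_iff[OF inj that xy(1)] inj_on_eq_iff[OF inj that xy(3)] xy by linarith
      then have "{v \<in> V. f v \<le> 1} = {x, y}"
        using xy by blast
      moreover have "x \<noteq> y" using xy by auto
      ultimately show ?thesis
        using even_span_or_translate[of x y "A \<triangle> ranked V f"] \<open>even p\<close> xy
          tournament_on_sdiff[OF A tournament_on_ranked[OF inj]]
        by (intro acyclic_reachable[OF inj, of _ _ 1]) auto
    next
      assume "card {v \<in> V. even (card (A `` {v}))} = (card V + 1) div 2"
      from ranking_with_parity[OF V(1) this] obtain f where f: "bij_betw f V {..<n}"
        and par: "\<And>v. v \<in> V \<Longrightarrow> even (f v) \<longleftrightarrow> even (card (A `` {v}))"
        using V by metis
      then have inj: "inj_on f V" by (simp add: bij_betw_def)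
      obtain x y z where xyz: "x \<in> V" "f x = 0" "y \<in> V" "f y = 1" "z \<in> V" "f z = 2"
        using bottom[OF f, of 0] bottom[OF f, of 1] bottom[OF f, of 2] by auto
      \<comment> \<open>The three lowest vertices span the triangle of
        \<open>even_degree_span_or_translate\<close>, with \<open>x\<close> as
        \<open>r\<close>.\<close>
      have "f v \<le> 2 \<longleftrightarrow> v = x \<or> v = y \<or> v = z" if "v \<in> V" for v
        using inj_on_eq_iff[OF inj that xyz(1)] inj_on_eq_iff[OF inj that xyz(3)]
          inj_on_eq_iff[OF inj that xyz(5)] xyz by linarith
      then have eq: "{v \<in> V. f v \<le> 2} = {x, y, z}"
        using xyz by blast
      \<comment> \<open>In \<open>ranked V f\<close> the out-degree of \<open>v\<close> is
        \<open>f v\<close>, of the same parity as in \<open>A\<close>, so the difference has even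
        degrees.\<close>
      have "even (card ((A \<triangle> ranked V f) `` {v}))" for v
      proof (cases "v \<in> V")
        case True
        have "finite (ranked V f `` {v})"
          using V by (auto intro!: finite_subset[of _ V] simp: ranked_def)
        then show ?thesis
          using finA card_ranked_Image[OF f True] par[OF True]
          by (simp add: Image_sdiff_singleton even_card_sdiff)
      next
        case False
        then have "A `` {v} = {}" "ranked V f `` {v} = {}"
          using A by (auto simp: tournament_on_def ranked_def)
        then show ?thesis by (simp add: Image_sdiff_singleton)
      qed
      moreover have "distinct [x, y, z]" using xyz by auto
      ultimately have "A \<triangle> ranked V f \<in> W \<or> A \<triangle> ranked V f \<triangle> clique {x, y, z} \<in> W"
        using xyz tournament_on_sdiff[OF A tournament_on_ranked[OF inj]]
        by (intro even_degree_span_or_translate)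
      then show ?thesis
        unfolding eq[symmetric] by (rule acyclic_reachable[OF inj])
    qed
  qed
  then show ?thesis
    by (simp only: eq_invertible_iff[OF assms(3)] count V(3) A_def[symmetric])
qed

end
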